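(* Let $p$ be a positive integer such that $p\equiv 3\pmod 4$. The following are equivalent. (i) There exists a balancedly multi-splittable $p^2\times p(p+1)$ partial Hadamard matrix. (ii) There exist an orthogonal array $\mathrm{OA}_1(p^2,p+1,p,2)$ and a $p\times(p+1)$ partial Hadamard matrix.
   Context: An $m\times n$ partial Hadamard matrix is an $m\times n$ matrix $H$ with entries in $\{1,-1\}$ such that $HH^\top=nI_m$. For $p\equiv 3\pmod 4$, a $p^2\times p(p+1)$ partial Hadamard matrix $H$ is balancedly multi-splittable if it can be put in a block form $H=[H_1\ \cdots\ H_{p+1}]$ (a partition of its columns), each $H_i$ being a $p^2\times p$ matrix, such that for every $(p+1)/2$-element subset $\{i_1,\ldots,i_{(p+1)/2}\}$ of $\{1,\ldots,p+1\}$ the matrix $H$ is balancedly splittable with respect to the submatrix $H'=[H_{i_1}\ \cdots\ H_{i_{(p+1)/2}}]$, i.e. all off-diagonal entries of $H'(H')^\top$ lie in $\{\frac{p+1}{2},-\frac{p+1}{2}\}$. An $\mathrm{OA}_1(p^2,p+1,p,2)$ is an orthogonal array of strength 2 and index 1: a $p^2\times(p+1)$ array with entries from a set of $p$ symbols such that in any two distinct columns every ordered pair of symbols occurs in exactly one row. *)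

theory Defs
  imports
    "Jordan_Normal_Form.DL_Submatrix"
    "HOL-Library.Disjoint_Sets"
begin

definition partial_hadamard :: "nat \<Rightarrow> nat \<Rightarrow> int mat \<Rightarrow> bool" where
  "partial_hadamard m n H \<longleftrightarrow>
     H \<in> carrier_mat m n \<and> elements_mat H \<subseteq> {1, -1} \<and>
     H * transpose_mat H = int n \<cdot>\<^sub>m 1\<^sub>m m"

(* J is the set of column indices of the submatrix H'. *)
definition balancedly_splittable_wrt :: "int mat \<Rightarrow> nat set \<Rightarrow> int \<Rightarrow> bool" where
  "balancedly_splittable_wrt H J a \<longleftrightarrow>
     (let H' = submatrix H UNIV J in
       \<forall>i < dim_row H. \<forall>j < dim_row H. i \<noteq> j \<longrightarrow>
         (H' * transpose_mat H') $$ (i, j) \<in> {a, -a})"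

(* A block H_i is represented by its set of column indices, so the block form is a partition
   \<B> of the columns into p + 1 sets of size p, not necessarily intervals. The selected blocks
   keep their columns in the order of H; permuting the columns of H' does not change H' * H'^T.
   For odd p the truncating division (p + 1) div 2 is exact. *)
definition balancedly_multi_splittable :: "nat \<Rightarrow> int mat \<Rightarrow> bool" where
  "balancedly_multi_splittable p H \<longleftrightarrow>
     (\<exists>\<B>. partition_on {..<p * (p + 1)} \<B> \<and> card \<B> = p + 1 \<and> (\<forall>B\<in>\<B>. card B = p) \<and>
       (\<forall>\<C>\<subseteq>\<B>. card \<C> = (p + 1) div 2 \<longrightarrow>
         balancedly_splittable_wrt H (\<Union>\<C>) (int ((p + 1) div 2))))"

(* An OA_1(N, k, v, 2) over the symbol set S (strength 2, index 1). *)
definition orthogonal_array :: "nat \<Rightarrow> nat \<Rightarrow> nat \<Rightarrow> 'a set \<Rightarrow> 'a mat \<Rightarrow> bool" where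
  "orthogonal_array N k v S A \<longleftrightarrow>
     finite S \<and> card S = v \<and> A \<in> carrier_mat N k \<and> elements_mat A \<subseteq> S \<and>
     (\<forall>c < k. \<forall>d < k. c \<noteq> d \<longrightarrow>
       (\<forall>x\<in>S. \<forall>y\<in>S. \<exists>!r. r < N \<and> A $$ (r, c) = x \<and> A $$ (r, d) = y))"

end

theory Submission
  imports Defs
begin

text \<open>Fix two distinct rows of a splittable matrix and let $a_1, \ldots, a_{p+1}$ be their inner
products on the blocks. The $a_i$ sum to $0$ because the rows are orthogonal, and every half of them
sums to $\pm(p+1)/2$. A swapping argument shows that this is very rigid: for a sign $e$, one of the
numbers is $e p$ and all others are $-e$ (\<open>subset_sums_exceptional_entry\<close>). As a block has $p$
columns, the value $e p$ means that the two rows agree up to the sign $e$ on that block.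

The sign $e$ depends on the pair of rows, but the product of the signs over any three rows is $1$, so
that negating some rows of the matrix makes every $e$ equal to $1$ (\<open>sign_normalisation\<close>). After
that, two distinct rows coincide on exactly one block and have inner product $-1$ on all others. Take
the rows as points and the sets of rows that coincide on a block as lines. Then the $p + 1$ blocks
are parallel classes of lines, and any two points are on exactly one line. A point off a line is
joined to the points of that line by lines of distinct classes, so a line has at most $p$ points;
since there are $p^2$ points, counting from a single point shows that every line has exactly $p$
(\<open>affine_plane_class_card\<close>). Thus the points form an affine plane of order $p$, and its line labels are the
orthogonal array. The $p$ points of a line of one class have pairwise inner product $-1$ on any other
block; putting a column of ones in front of this $p \times p$ matrix gives the
$p \times (p+1)$ partial Hadamard matrix.

Conversely, normalise the first column of the $p \times (p+1)$ matrix to ones and delete it: the rows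
become $p$ vectors with pairwise inner product $-1$. Substitute them for the symbols of the array.
Two rows of the array agree in exactly one column (\<open>orthogonal_array_rows_agree_once\<close>), so the
inner products on the blocks are once $p$ and $p$ times $-1$. Their sum is $0$, and the sum over a half
is $\pm(p+1)/2$, according to whether the exceptional block was chosen.\<close>

section \<open>Subset sums\<close>

text \<open>Not all entries are equal, since their sum is $0$ and no half sums to $0$. Take $a_i > a_j$.
Exchanging $i$ for $j$ in a half lowers its sum, hence changes it from $q$ to $-q$. So all
$(q-1)$-subsets of the remaining indices have the same sum, and by exchanging elements again all
remaining entries equal a common $x$. A half inside the remaining indices has sum $q x$, so that
$x = \pm 1$, and $a_i$ and $a_j$ are determined by $x$. The last step needs $q$ remaining indices,
that is $q \ge 2$.\<close>

lemma subset_sums_exceptional_entry: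
  fixes a :: "'i \<Rightarrow> int"
  assumes fin: "finite I" and card_I: "card I = 2 * q" and q: "q \<ge> 2"
    and zero: "sum a I = 0"
    and half: "\<And>C. C \<subseteq> I \<Longrightarrow> card C = q \<Longrightarrow> sum a C \<in> {int q, - int q}"
  shows "\<exists>e\<in>{1, -1}. \<exists>i\<in>I. a i = e * (2 * int q - 1) \<and> (\<forall>j\<in>I - {i}. a j = - e)"
proof -
  obtain i j where ij: "i \<in> I" "j \<in> I" "a j < a i"
  proof -
    have "\<exists>i\<in>I. \<exists>j\<in>I. a j < a i"
    proof (rule ccontr)
      assume "\<not> ?thesis"
      then have const: "a i = a j" if "i \<in> I" "j \<in> I" for i j
        using that by (metis linorder_less_linear)
      have "I \<noteq> {}" using card_I q by auto
      then obtain k where k: "k \<in> I" by auto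
      have "sum a I = (\<Sum>i\<in>I. a k)" by (intro sum.cong refl const k)
      then have "a k = 0" using zero card_I q by simp
      then have all0: "a i = 0" if "i \<in> I" for i using const k that by metis
      obtain C where C: "C \<subseteq> I" "card C = q"
        by (rule obtain_subset_with_card_n[of q I]) (use card_I in auto)
      have "sum a C = 0" using C all0 by (intro sum.neutral) auto
      then show False using half[OF C] q by auto
    qed
    then show thesis using that by blast
  qed
  define J where "J = I - {i, j}"
  have ne: "i \<noteq> j" using ij by auto
  have finJ: "finite J" and JI: "J \<subseteq> I" and notJ: "i \<notin> J" "j \<notin> J" using fin J_def by auto
  have card_J: "card J = 2 * q - 2"
    unfolding J_def using fin card_I ij ne by (simp add: card_Diff_subset)
  \<comment> \<open>The two sums differ and the one with \<open>i\<close> is larger, which leaves only one choice of values.\<close>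
  have swap: "a i + sum a D = int q \<and> a j + sum a D = - int q"
    if D: "D \<subseteq> J" "card D = q - 1" for D
  proof -
    have finD: "finite D" and nD: "i \<notin> D" "j \<notin> D"
      using D finJ notJ finite_subset by auto
    have "sum a (insert i D) \<in> {int q, - int q}" "sum a (insert j D) \<in> {int q, - int q}"
      using D finD nD q ij JI half[of "insert i D"] half[of "insert j D"] by auto
    then show ?thesis using finD nD ij(3) by auto
  qed
  have const: "a k = a l" if "k \<in> J" "l \<in> J" for k l
  proof (cases "k = l")
    case False
    have "card (J - {k, l}) = 2 * q - 4"
      using that False finJ card_J by (simp add: card_Diff_subset)
    then have "q - 2 \<le> card (J - {k, l})" by linarith
    then obtain D where D: "D \<subseteq> J - {k, l}" "card D = q - 2"
      by (rule obtain_subset_with_card_n[of "q - 2" "J - {k, l}"])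
    have finD: "finite D" using D finJ finite_subset by blast
    have kl: "k \<notin> D" "l \<notin> D" using D by auto
    then have "card (insert k D) = q - 1" "card (insert l D) = q - 1"
      using finD D q by auto
    then have "a i + sum a (insert k D) = int q" "a i + sum a (insert l D) = int q"
      using D that swap[of "insert k D"] swap[of "insert l D"] by auto
    then show ?thesis using finD kl by simp
  qed simp
  have "J \<noteq> {}" using card_J q by auto
  then obtain k where k: "k \<in> J" by auto
  have sumJ: "sum a D = int (card D) * a k" if "D \<subseteq> J" for D
  proof -
    have "sum a D = (\<Sum>i\<in>D. a k)" by (intro sum.cong refl const k) (use that in blast)
    then show ?thesis by simp
  qed
  obtain C where C: "C \<subseteq> J" "card C = q"
    by (rule obtain_subset_with_card_n[of q J]) (use card_J q in auto)
  have "int q * a k \<in> {int q, - int q}" using half[of C] C JI sumJ[of C] by auto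
  then have "int q * a k = int q * 1 \<or> int q * a k = int q * (- 1)" by auto
  then have ak: "a k = 1 \<or> a k = -1"
    using q unfolding mult_cancel_left by auto
  obtain D where D: "D \<subseteq> J" "card D = q - 1"
    by (rule obtain_subset_with_card_n[of "q - 1" J]) (use card_J q in auto)
  have eqs: "a i + (int q - 1) * a k = int q" "a j + (int q - 1) * a k = - int q"
    using swap[OF D] sumJ[OF D(1)] D q by (auto simp: of_nat_diff)
  have rest: "l \<in> J" if "l \<in> I" "l \<noteq> i" "l \<noteq> j" for l using that J_def by auto
  show ?thesis
  proof (cases "a k = 1")
    case True
    then have "a i = 1" "a j = -1 * (2 * int q - 1)" using eqs by auto
    moreover have "a l = - (-1)" if "l \<in> I - {j}" for l
      using rest[of l] const[of l k] k True \<open>a i = 1\<close> that by (cases "l = i") auto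
    ultimately show ?thesis using ij by blast
  next
    case False
    then have m: "a k = -1" using ak by simp
    then have "a j = -1" "a i = 1 * (2 * int q - 1)" using eqs by auto
    moreover have "a l = - 1" if "l \<in> I - {i}" for l
      using rest[of l] const[of l k] k m \<open>a j = -1\<close> that by (cases "l = j") auto
    ultimately show ?thesis using ij by blast
  qed
qed

section \<open>Inner products of rows\<close>

definition block_inner :: "('r \<Rightarrow> 'c \<Rightarrow> int) \<Rightarrow> 'c set \<Rightarrow> 'r \<Rightarrow> 'r \<Rightarrow> int" where
  "block_inner h B r s = (\<Sum>k\<in>B. h r k * h s k)"

lemma block_inner_commute: "block_inner h B r s = block_inner h B s r"
  by (simp add: block_inner_def mult.commute)

lemma block_inner_scale:
  "block_inner (\<lambda>r k. u r * h r k) B r s = u r * u s * block_inner h B r s"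
  by (simp add: block_inner_def sum_distrib_left mult.assoc mult.left_commute)

lemma block_inner_cong_row:
  assumes "\<And>k. k \<in> B \<Longrightarrow> h r k = e * h s k"
  shows "block_inner h B r t = e * block_inner h B s t"
  using assms by (simp add: block_inner_def sum_distrib_left mult.assoc)

lemma block_inner_Union:
  assumes "pairwise disjnt \<C>" "\<And>B. B \<in> \<C> \<Longrightarrow> finite B"
  shows "block_inner h (\<Union>\<C>) r s = (\<Sum>B\<in>\<C>. block_inner h B r s)"
  unfolding block_inner_def
  using assms by (subst sum.Union_disjoint) (auto simp: pairwise_def disjnt_def)

lemma block_inner_self:
  assumes "\<And>k. k \<in> B \<Longrightarrow> h r k \<in> {1, -1}"
  shows "block_inner h B r r = int (card B)"
proof -
  have "block_inner h B r r = (\<Sum>k\<in>B. 1)"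
    unfolding block_inner_def
  proof (rule sum.cong)
    show "h r k * h r k = 1" if "k \<in> B" for k using assms[OF that] by auto
  qed simp
  then show ?thesis by simp
qed

text \<open>Equality case of the Cauchy-Schwarz inequality for sign vectors: the terms
$1 - e\, h_{rk} h_{sk}$ are nonnegative and sum to $0$.\<close>

lemma block_inner_extreme:
  assumes fin: "finite B"
    and pm: "\<And>k. k \<in> B \<Longrightarrow> h r k \<in> {1, -1}" "\<And>k. k \<in> B \<Longrightarrow> h s k \<in> {1, -1}"
    and e: "e \<in> {1, -1}" and ext: "block_inner h B r s = e * int (card B)"
    and k: "k \<in> B"
  shows "h r k = e * h s k"
proof -
  have "(\<Sum>k\<in>B. 1 - e * (h r k * h s k)) = int (card B) - e * block_inner h B r s"
    by (simp add: sum_subtractf block_inner_def sum_distrib_left)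
  also have "\<dots> = 0" using e ext by auto
  finally have "(\<Sum>k\<in>B. 1 - e * (h r k * h s k)) = 0" .
  moreover have "0 \<le> 1 - e * (h r k * h s k)" if "k \<in> B" for k
    using pm(1)[OF that] pm(2)[OF that] e by auto
  ultimately have "1 - e * (h r k * h s k) = 0"
    using k fin by (subst (asm) sum_nonneg_eq_0_iff) auto
  then show ?thesis using pm(1)[OF k] pm(2)[OF k] e by auto
qed

text \<open>The squared norm of the sum of all the vectors is $N (p + 1 - N)$ for $N$ vectors, and it
cannot be negative.\<close>

lemma simplex_card_le:
  assumes fin: "finite R" "finite B"
    and self: "\<And>r. r \<in> R \<Longrightarrow> block_inner h B r r = int p"
    and other: "\<And>r s. r \<in> R \<Longrightarrow> s \<in> R \<Longrightarrow> r \<noteq> s \<Longrightarrow> block_inner h B r s = -1"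
  shows "card R \<le> p + 1"
proof (rule ccontr)
  assume big: "\<not> ?thesis"
  have row: "(\<Sum>s\<in>R. block_inner h B r s) = int p + 1 - int (card R)" if r: "r \<in> R" for r
  proof -
    have "(\<Sum>s\<in>R. block_inner h B r s) = block_inner h B r r + (\<Sum>s\<in>R - {r}. block_inner h B r s)"
      using fin r by (simp add: sum.remove)
    also have "(\<Sum>s\<in>R - {r}. block_inner h B r s) = (\<Sum>s\<in>R - {r}. -1)"
      using other r by (intro sum.cong) auto
    finally show ?thesis
      using self[OF r] fin r card_gt_0_iff[of R] by (auto simp: of_nat_diff)
  qed
  have "0 \<le> (\<Sum>k\<in>B. (\<Sum>r\<in>R. h r k)\<^sup>2)" by (intro sum_nonneg) auto
  also have "\<dots> = (\<Sum>k\<in>B. \<Sum>r\<in>R. \<Sum>s\<in>R. h r k * h s k)"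
    by (simp add: power2_eq_square sum_product)
  also have "\<dots> = (\<Sum>r\<in>R. \<Sum>s\<in>R. block_inner h B r s)"
    unfolding block_inner_def
    by (subst sum.swap, rule sum.cong[OF refl], rule sum.swap)
  also have "\<dots> = int (card R) * (int p + 1 - int (card R))"
    using row by simp
  also have "\<dots> < 0" using big by (intro mult_pos_neg) auto
  finally show False by simp
qed

section \<open>Normalising the signs of rows\<close>

text \<open>Call $e$ the sign of the pair $r, s$. Fix a row $z$ and let $u_r$ be the sign of the pair
$z, r$. It has to be shown that the pair $r, s$ has sign $u_r u_s$. On the exceptional block of
$r, s$ the row $r$ is $e$ times the row $s$, so that their inner products with $z$ differ by the
factor $e$. In particular both have absolute value $p$ or both have absolute value $1$, and in either
case the ratio of these inner products is $u_r u_s$.\<close>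

lemma sign_normalisation:
  fixes h :: "'r \<Rightarrow> 'c \<Rightarrow> int"
  assumes pm: "\<And>r B k. r \<in> R \<Longrightarrow> B \<in> \<B> \<Longrightarrow> k \<in> B \<Longrightarrow> h r k \<in> {1, -1}"
    and fin: "\<And>B. B \<in> \<B> \<Longrightarrow> finite B" and card_B: "\<And>B. B \<in> \<B> \<Longrightarrow> card B = p"
    and p: "p > 1"
    and pair: "\<And>r s. r \<in> R \<Longrightarrow> s \<in> R \<Longrightarrow> r \<noteq> s \<Longrightarrow>
      \<exists>e\<in>{1, -1}. \<exists>B\<in>\<B>. block_inner h B r s = e * int p \<and>
        (\<forall>B'\<in>\<B> - {B}. block_inner h B' r s = - e)"
  shows "\<exists>u. (\<forall>r\<in>R. u r \<in> {1, -1}) \<and> (\<forall>r\<in>R. \<forall>s\<in>R. r \<noteq> s \<longrightarrow>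
    (\<exists>B\<in>\<B>. block_inner h B r s = u r * u s * int p \<and>
      (\<forall>B'\<in>\<B> - {B}. block_inner h B' r s = - (u r * u s))))"
proof (cases "R = {}")
  case False
  then obtain z where z: "z \<in> R" by auto
  define Q where "Q e r s \<longleftrightarrow> (\<exists>B\<in>\<B>. block_inner h B r s = e * int p \<and>
        (\<forall>B'\<in>\<B> - {B}. block_inner h B' r s = - e))" for e r s
  have Q_sym: "Q e r s \<Longrightarrow> Q e s r" for e r s
    unfolding Q_def using block_inner_commute[of h _ r s] by simp
  have "\<exists>e\<in>{1, -1}. Q e z r" if "r \<in> R" "r \<noteq> z" for r
    using pair[OF z that(1)] that(2) unfolding Q_def by blast
  then have "\<forall>r\<in>R - {z}. \<exists>e. e \<in> {1, -1} \<and> Q e z r" by blast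
  from bchoice[OF this] obtain f
    where f: "f r \<in> {1, -1}" "Q (f r) z r" if "r \<in> R" "r \<noteq> z" for r
    by auto
  define u where "u r = (if r = z then 1 else f r)" for r
  have u: "u r \<in> {1, -1}" if "r \<in> R" for r using f that by (auto simp: u_def)
  have "Q (u r * u s) r s" if rs: "r \<in> R" "s \<in> R" "r \<noteq> s" for r s
  proof (cases "r = z \<or> s = z")
    case True
    then show ?thesis using f rs Q_sym by (auto simp: u_def)
  next
    case False
    obtain e B where e: "e \<in> {1, -1}" and B: "B \<in> \<B>" "block_inner h B r s = e * int p"
      and Q: "Q e r s"
      using pair[OF rs] unfolding Q_def by blast
    have "h r k = e * h s k" if "k \<in> B" for k
      using block_inner_extreme[of B h r s e k] B e rs pm fin card_B that by auto
    then have tri: "block_inner h B r z = e * block_inner h B s z"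
      by (rule block_inner_cong_row)
    have "block_inner h B t z = u t * int p \<or> block_inner h B t z = - u t"
      if t: "t \<in> R" "t \<noteq> z" for t
    proof -
      obtain B' where B': "B' \<in> \<B>" "block_inner h B' z t = u t * int p"
        "\<forall>B''\<in>\<B> - {B'}. block_inner h B'' z t = - u t"
        using f(2)[OF t] t(2) unfolding Q_def u_def by auto
      show ?thesis using B' B(1) by (cases "B' = B") (auto simp: block_inner_commute[of h B t])
    qed
    from this[of r] this[of s]
    have "block_inner h B r z = u r * int p \<or> block_inner h B r z = - u r"
      "block_inner h B s z = u s * int p \<or> block_inner h B s z = - u s"
      using rs False by auto
    moreover have "u r = 1 \<or> u r = -1" "u s = 1 \<or> u s = -1" "e = 1 \<or> e = -1"
      using u[of r] u[of s] rs e by auto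
    ultimately have "u r = e * u s"
      using tri p by (elim disjE) simp_all
    then have "e = u r * u s" using u[of s] rs by auto
    then show ?thesis using Q by simp
  qed
  then show ?thesis using u unfolding Q_def by blast
qed simp

section \<open>Affine planes and orthogonal arrays\<close>

text \<open>The points are the elements of $R$, and the lines of the parallel class $i$ are the
equivalence classes of $E_i$. Given a line of class $j$ and a point $z$ off it, sending a point of
the line to the class of the line joining it to $z$ is injective: two points with the same image would
be joined by a line of that class as well as by the given one. As the value $j$ is not taken, the line
has at most $n$ points. The $n + 1$ lines through $r$ cover the other $n^2 - 1 = (n+1)(n-1)$ points,
so each of them has exactly $n$ points.\<close>

lemma affine_plane_class_card:
  fixes E :: "'i \<Rightarrow> ('r \<times> 'r) set"
  assumes fin_R: "finite R" and card_R: "card R = n\<^sup>2"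
    and fin_I: "finite I" and card_I: "card I = n + 1"
    and equiv: "\<And>i. i \<in> I \<Longrightarrow> equiv R (E i)"
    and join: "\<And>r s. r \<in> R \<Longrightarrow> s \<in> R \<Longrightarrow> r \<noteq> s \<Longrightarrow> \<exists>!i. i \<in> I \<and> (r, s) \<in> E i"
    and proper: "\<And>i r. i \<in> I \<Longrightarrow> r \<in> R \<Longrightarrow> E i `` {r} \<noteq> R"
    and i: "i \<in> I" and r: "r \<in> R"
  shows "card (E i `` {r}) = n"
proof -
  have sub: "E j `` {r} \<subseteq> R" if "j \<in> I" for j
    using equiv[OF that] by (auto simp: equiv_def refl_on_def)
  have sym: "(x, y) \<in> E j \<Longrightarrow> (y, x) \<in> E j"
    and trans: "(x, y) \<in> E j \<Longrightarrow> (y, z) \<in> E j \<Longrightarrow> (x, z) \<in> E j" if "j \<in> I" for j x y z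
    using equiv[OF that] by (auto simp: equiv_def elim: symE transE)
  have self: "r \<in> E j `` {r}" if "j \<in> I" for j
    using equiv[OF that] r by (auto simp: equiv_def refl_on_def)
  have le: "card (E j `` {r}) \<le> n" if j: "j \<in> I" for j
  proof -
    obtain z where z: "z \<in> R" "(r, z) \<notin> E j" using sub[OF j] proper[OF j r] by auto
    have "\<exists>k. k \<in> I - {j} \<and> (y, z) \<in> E k" if y: "(r, y) \<in> E j" for y
    proof -
      have "y \<in> R" "y \<noteq> z" "(y, z) \<notin> E j" using sub[OF j] y z trans[OF j y] by auto
      then show ?thesis using join[of y z] z by auto
    qed
    then have "\<forall>y\<in>E j `` {r}. \<exists>k. k \<in> I - {j} \<and> (y, z) \<in> E k" by blast
    from bchoice[OF this] obtain f
      where f: "\<And>y. (r, y) \<in> E j \<Longrightarrow> f y \<in> I - {j} \<and> (y, z) \<in> E (f y)" by auto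
    have "inj_on f (E j `` {r})"
    proof (rule inj_onI, rule ccontr)
      fix x y assume xy: "x \<in> E j `` {r}" "y \<in> E j `` {r}" "f x = f y" "x \<noteq> y"
      have "(x, y) \<in> E (f x)" "(x, y) \<in> E j"
        using xy f[of x] f[of y] sym trans j by (metis Diff_iff Image_singleton_iff)+
      moreover have "x \<in> R" "y \<in> R" using xy sub[OF j] by auto
      ultimately show False using join[of x y] xy f[of x] j by auto
    qed
    then have "card (E j `` {r}) \<le> card (I - {j})"
      using f fin_I by (intro card_inj_on_le[of f]) auto
    then show ?thesis using card_I j fin_I by simp
  qed
  have cover: "R - {r} \<subseteq> (\<Union>j\<in>I. E j `` {r} - {r})"
  proof
    fix s assume "s \<in> R - {r}"
    then show "s \<in> (\<Union>j\<in>I. E j `` {r} - {r})" using join[of r s] r by auto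
  qed
  have card_less: "card (E j `` {r} - {r}) = card (E j `` {r}) - 1" if "j \<in> I" for j
    using self[OF that] by simp
  have "n\<^sup>2 - 1 = card (R - {r})" using card_R r by simp
  also have "\<dots> \<le> card (\<Union>j\<in>I. E j `` {r} - {r})"
    using sub fin_R fin_I by (intro card_mono[OF _ cover]) (auto intro: finite_subset)
  also have "\<dots> \<le> (\<Sum>j\<in>I. card (E j `` {r} - {r}))"
    by (rule card_UN_le[OF fin_I])
  also have "\<dots> = (\<Sum>j\<in>I. card (E j `` {r}) - 1)" using card_less by simp
  finally have lower: "n\<^sup>2 - 1 \<le> (\<Sum>j\<in>I. card (E j `` {r}) - 1)" .
  have "0 < card R" using r fin_R card_gt_0_iff by auto
  then have n: "0 < n" using card_R by (cases n) auto
  show ?thesis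
  proof (rule ccontr)
    assume "card (E i `` {r}) \<noteq> n"
    moreover have "card (E i `` {r}) > 0"
      using self[OF i] sub[OF i] fin_R by (auto simp: card_gt_0_iff intro: finite_subset)
    ultimately have "card (E i `` {r}) - 1 < n - 1" using le[OF i] by linarith
    then have "(\<Sum>j\<in>I. card (E j `` {r}) - 1) < (\<Sum>j\<in>I. n - 1)"
      using fin_I i le by (intro sum_strict_mono_ex1) (auto intro: diff_le_mono)
    also have "\<dots> = n\<^sup>2 - 1"
      using card_I n by (simp add: power2_eq_square algebra_simps)
    finally show False using lower by simp
  qed
qed

lemma card_quotient_eq:
  assumes fin: "finite R" and equiv: "equiv R E"
    and cls: "\<And>r. r \<in> R \<Longrightarrow> card (E `` {r}) = n" and card_R: "card R = n * m" and n: "n > 0"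
  shows "card (R // E) = m"
proof -
  have "n * card (R // E) = card (\<Union>(R // E))"
  proof (rule card_partition)
    show "finite (R // E)" using fin equiv by (intro finite_quotient) (auto simp: equiv_def refl_on_def)
    show "finite (\<Union>(R // E))" using fin equiv by (simp add: Union_quotient)
    show "card c = n" if "c \<in> R // E" for c using that cls by (auto elim!: quotientE)
    show "c \<inter> d = {}" if "c \<in> R // E" "d \<in> R // E" "c \<noteq> d" for c d
      using quotient_disj[OF equiv that(1,2)] that(3) by auto
  qed
  then show ?thesis using equiv card_R n by (simp add: Union_quotient)
qed

text \<open>The entry in row $r$ and column $c$ is the number of the line of the $c$-th parallel class
through the point $r$. Two lines of different classes meet at most once, so the $n$ points of a line
lie on $n$ different lines of any other class; since there are only $n$ of these, all are met.\<close>

lemma orthogonal_array_of_affine_plane: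
  fixes E :: "'i \<Rightarrow> (nat \<times> nat) set"
  assumes n: "n > 0" and card_I: "card I = k" and fin_I: "finite I"
    and equiv: "\<And>i. i \<in> I \<Longrightarrow> equiv {..<n\<^sup>2} (E i)"
    and meet: "\<And>i j r s. i \<in> I \<Longrightarrow> j \<in> I \<Longrightarrow> i \<noteq> j \<Longrightarrow> r \<noteq> s \<Longrightarrow> (r, s) \<in> E i \<Longrightarrow> (r, s) \<notin> E j"
    and cls: "\<And>i r. i \<in> I \<Longrightarrow> r < n\<^sup>2 \<Longrightarrow> card (E i `` {r}) = n"
  shows "\<exists>A. orthogonal_array (n\<^sup>2) k n {..<n} A"
proof -
  have card_q: "card ({..<n\<^sup>2} // E i) = n" if "i \<in> I" for i
    using that cls equiv n by (intro card_quotient_eq) (auto simp: power2_eq_square)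
  have fin_q: "finite ({..<n\<^sup>2} // E i)" if "i \<in> I" for i
    using card_q[OF that] n card_ge_0_finite by metis
  have "\<exists>f. bij_betw f ({..<n\<^sup>2} // E i) {..<n}" if "i \<in> I" for i
    using finite_same_card_bij[OF fin_q[OF that], of "{..<n}"] card_q[OF that] by simp
  then have "\<forall>i\<in>I. \<exists>f. bij_betw f ({..<n\<^sup>2} // E i) {..<n}" by blast
  from bchoice[OF this] obtain f
    where f: "\<And>i. i \<in> I \<Longrightarrow> bij_betw (f i) ({..<n\<^sup>2} // E i) {..<n}" by auto
  obtain \<iota> where \<iota>: "bij_betw \<iota> {..<k} I"
    using ex_bij_betw_nat_finite[OF fin_I] card_I by (auto simp: atLeast0LessThan)
  have \<iota>I: "\<iota> c \<in> I" if "c < k" for c using \<iota> that by (auto simp: bij_betw_def)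
  define lab where "lab r c = f (\<iota> c) (E (\<iota> c) `` {r})" for r c
  define A where "A = mat (n\<^sup>2) k (\<lambda>(r, c). lab r c)"
  have lab_mem: "lab r c < n" if "r < n\<^sup>2" "c < k" for r c
    using bij_betwE[OF f[OF \<iota>I[OF that(2)]]] that unfolding lab_def by (auto intro: quotientI)
  have lab_eq: "lab r c = lab s c \<longleftrightarrow> (r, s) \<in> E (\<iota> c)" if "r < n\<^sup>2" "s < n\<^sup>2" "c < k" for r s c
  proof -
    have "lab r c = lab s c \<longleftrightarrow> E (\<iota> c) `` {r} = E (\<iota> c) `` {s}"
      unfolding lab_def using f[OF \<iota>I[OF that(3)]] that
      by (intro inj_on_eq_iff[of "f (\<iota> c)"]) (auto simp: bij_betw_def intro: quotientI)
    then show ?thesis using eq_equiv_class_iff[OF equiv[OF \<iota>I[OF that(3)]]] that by auto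
  qed
  have uniq: "\<exists>!r. r < n\<^sup>2 \<and> lab r c = x \<and> lab r d = y"
    if cd: "c < k" "d < k" "c \<noteq> d" and xy: "x < n" "y < n" for c d x y
  proof -
    have ne: "\<iota> c \<noteq> \<iota> d" using \<iota> cd by (auto simp: bij_betw_def inj_on_def)
    have one: "r = s" if "r < n\<^sup>2" "s < n\<^sup>2" "lab r c = lab s c" "lab r d = lab s d" for r s
      using meet[OF \<iota>I[OF cd(1)] \<iota>I[OF cd(2)] ne, of r s] that lab_eq[of r s] cd by auto
    have "x \<in> f (\<iota> c) ` ({..<n\<^sup>2} // E (\<iota> c))"
      using f[OF \<iota>I[OF cd(1)]] xy by (auto simp: bij_betw_def)
    then obtain r0 where r0: "r0 < n\<^sup>2" "lab r0 c = x"
      unfolding lab_def by (auto elim!: quotientE)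
    define X where "X = E (\<iota> c) `` {r0}"
    have X: "r < n\<^sup>2 \<and> lab r c = x" if "r \<in> X" for r
    proof -
      have "r < n\<^sup>2" using that equiv[OF \<iota>I[OF cd(1)]] X_def by (auto simp: equiv_def refl_on_def)
      then show ?thesis using lab_eq[of r0 r c] r0 cd that X_def by auto
    qed
    have "inj_on (\<lambda>r. lab r d) X"
    proof (rule inj_onI)
      fix r s assume "r \<in> X" "s \<in> X" "lab r d = lab s d"
      then show "r = s" using one[of r s] X[of r] X[of s] by simp
    qed
    then have "card ((\<lambda>r. lab r d) ` X) = n"
      using cls[OF \<iota>I[OF cd(1)] r0(1)] by (simp add: card_image X_def)
    moreover have "(\<lambda>r. lab r d) ` X \<subseteq> {..<n}" using X lab_mem cd by auto
    ultimately have "(\<lambda>r. lab r d) ` X = {..<n}" by (intro card_subset_eq) auto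
    then have "y \<in> (\<lambda>r. lab r d) ` X" using xy by simp
    then obtain r where r: "r \<in> X" "lab r d = y" by auto
    show ?thesis
    proof (rule ex1I[of _ r])
      show r_prop: "r < n\<^sup>2 \<and> lab r c = x \<and> lab r d = y"
        using X[OF r(1)] r(2) by simp
      show "s = r" if "s < n\<^sup>2 \<and> lab s c = x \<and> lab s d = y" for s
        using one[of s r] r_prop that by simp
    qed
  qed
  have Aidx: "A $$ (r, c) = lab r c" if "r < n\<^sup>2" "c < k" for r c
    using that by (simp add: A_def)
  have "orthogonal_array (n\<^sup>2) k n {..<n} A"
    unfolding orthogonal_array_def
  proof (intro conjI allI impI ballI)
    show "elements_mat A \<subseteq> {..<n}"
    proof
      fix a assume "a \<in> elements_mat A"
      then show "a \<in> {..<n}" using lab_mem by (auto simp: A_def)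
    qed
    fix c d x y assume "c < k" "d < k" "c \<noteq> d" "x \<in> {..<n}" "y \<in> {..<n}"
    then show "\<exists>!r. r < n\<^sup>2 \<and> A $$ (r, c) = x \<and> A $$ (r, d) = y"
      using uniq[of c d x y] by (simp add: Aidx cong: conj_cong)
  qed (auto simp: A_def)
  then show ?thesis by blast
qed

text \<open>Two rows cannot agree twice. Each symbol occurs $n$ times in a column, so $n - 1$ other rows
agree with $r$ in a given column; these sets of rows are disjoint for the $n + 1$ columns and
therefore exhaust the $n^2 - 1$ rows different from $r$.\<close>

lemma orthogonal_array_rows_agree_once:
  assumes oa: "orthogonal_array (n\<^sup>2) (n + 1) n S A"
    and r: "r < n\<^sup>2" and s: "s < n\<^sup>2" and rs: "r \<noteq> s"
  shows "\<exists>!c. c < n + 1 \<and> A $$ (r, c) = A $$ (s, c)"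
proof -
  have fin_S: "finite S" and card_S: "card S = n" and A: "A \<in> carrier_mat (n\<^sup>2) (n + 1)"
    and el: "elements_mat A \<subseteq> S"
    and uniq: "\<And>c d x y. c < n + 1 \<Longrightarrow> d < n + 1 \<Longrightarrow> c \<noteq> d \<Longrightarrow> x \<in> S \<Longrightarrow> y \<in> S \<Longrightarrow>
      \<exists>!r. r < n\<^sup>2 \<and> A $$ (r, c) = x \<and> A $$ (r, d) = y"
    using oa unfolding orthogonal_array_def by blast+
  have n: "n > 0" using r by (cases n) auto
  have mem: "A $$ (t, c) \<in> S" if "t < n\<^sup>2" "c < n + 1" for t c
    using el elements_matI[OF A that refl] by auto
  have once: "t = t'" if "t < n\<^sup>2" "t' < n\<^sup>2" "c < n + 1" "d < n + 1" "c \<noteq> d"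
    "A $$ (t, c) = A $$ (t', c)" "A $$ (t, d) = A $$ (t', d)" for t t' c d
    using uniq[OF that(3,4,5) mem[OF that(2,3)] mem[OF that(2,4)]] that by blast
  define T where "T c = {t. t < n\<^sup>2 \<and> A $$ (t, c) = A $$ (r, c)}" for c
  have fin_T: "finite (T c)" for c by (rule finite_subset[of _ "{..<n\<^sup>2}"]) (auto simp: T_def)
  \<comment> \<open>The entries in any second column map the rows in \<open>T c\<close> bijectively to the symbols.\<close>
  have card_T: "card (T c) = n" if c: "c < n + 1" for c
  proof -
    have "\<exists>d<n + 1. d \<noteq> c" using n by (intro exI[of _ "if c = 0 then 1 else 0"]) auto
    then obtain d where d: "d < n + 1" "d \<noteq> c" by blast
    have "bij_betw (\<lambda>t. A $$ (t, d)) (T c) S"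
      unfolding bij_betw_def
    proof
      show "inj_on (\<lambda>t. A $$ (t, d)) (T c)"
        using once c d by (intro inj_onI) (auto simp: T_def)
      show "(\<lambda>t. A $$ (t, d)) ` T c = S"
      proof
        show "S \<subseteq> (\<lambda>t. A $$ (t, d)) ` T c"
        proof
          fix y assume "y \<in> S"
          then obtain t where "t < n\<^sup>2" "A $$ (t, c) = A $$ (r, c)" "A $$ (t, d) = y"
            using uniq[OF c d(1) d(2)[symmetric] mem[OF r c]] by blast
          then show "y \<in> (\<lambda>t. A $$ (t, d)) ` T c" by (auto simp: T_def)
        qed
      qed (use mem d in \<open>auto simp: T_def\<close>)
    qed
    then show ?thesis using card_S bij_betw_same_card by blast
  qed
  have "card (\<Union>c\<in>{..<n + 1}. T c - {r}) = (\<Sum>c\<in>{..<n + 1}. card (T c - {r}))"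
  proof (rule card_UN_disjoint)
    show "\<forall>c\<in>{..<n + 1}. \<forall>d\<in>{..<n + 1}. c \<noteq> d \<longrightarrow> (T c - {r}) \<inter> (T d - {r}) = {}"
      using once[OF _ r] by (auto simp: T_def)
  qed (use fin_T in auto)
  also have "\<dots> = (\<Sum>c\<in>{..<n + 1}. n - 1)"
    using card_T r by (intro sum.cong) (auto simp: T_def)
  also have "\<dots> = card ({..<n\<^sup>2} - {r})"
    using r n by (simp add: power2_eq_square algebra_simps)
  finally have "(\<Union>c\<in>{..<n + 1}. T c - {r}) = {..<n\<^sup>2} - {r}"
    by (intro card_subset_eq) (auto simp: T_def)
  then have "s \<in> (\<Union>c\<in>{..<n + 1}. T c - {r})" using s rs by auto
  then obtain c where "c < n + 1" "A $$ (r, c) = A $$ (s, c)" by (auto simp: T_def)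
  then show ?thesis using once[OF r s] rs by blast
qed

section \<open>Gram matrices\<close>

lemma bij_betw_pick:
  assumes "finite J"
  shows "bij_betw (pick J) {..<card J} J"
proof -
  have inj: "inj_on (pick J) {..<card J}"
    by (rule linorder_inj_onI) (auto dest!: pick_mono_le)
  moreover have sub: "pick J ` {..<card J} \<subseteq> J" by (auto intro: pick_in_set_le)
  ultimately show ?thesis
    using assms card_subset_eq[OF assms sub] by (simp add: bij_betw_def card_image)
qed

lemma gram_submatrix:
  fixes H :: "int mat"
  assumes H: "H \<in> carrier_mat m n" and J: "J \<subseteq> {..<n}" and rs: "r < m" "s < m"
  shows "(submatrix H UNIV J * transpose_mat (submatrix H UNIV J)) $$ (r, s) =
    block_inner (\<lambda>r k. H $$ (r, k)) J r s"
proof -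
  let ?G = "submatrix H UNIV J"
  have fin: "finite J" using J finite_subset by blast
  have cJ: "{j. j < n \<and> j \<in> J} = J" using J by auto
  have dims: "dim_row ?G = m" "dim_col ?G = card J"
    using H by (simp_all add: dim_submatrix cJ)
  have idx: "?G $$ (t, k) = H $$ (t, pick J k)" if "t < m" "k < card J" for t k
    using submatrix_index[of t H UNIV k J] that H by (simp add: cJ pick_UNIV)
  have "(?G * transpose_mat ?G) $$ (r, s) = (\<Sum>k\<in>{..<card J}. ?G $$ (r, k) * ?G $$ (s, k))"
    using rs dims by (simp add: scalar_prod_def atLeast0LessThan)
  also have "\<dots> = (\<Sum>k\<in>{..<card J}. H $$ (r, pick J k) * H $$ (s, pick J k))"
    using idx rs by simp
  also have "\<dots> = block_inner (\<lambda>r k. H $$ (r, k)) J r s"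
    unfolding block_inner_def by (rule sum.reindex_bij_betw[OF bij_betw_pick[OF fin]])
  finally show ?thesis .
qed

lemma gram_index:
  fixes H :: "int mat"
  assumes "H \<in> carrier_mat m n" "r < m" "s < m"
  shows "(H * transpose_mat H) $$ (r, s) = block_inner (\<lambda>r k. H $$ (r, k)) {..<n} r s"
  using assms by (simp add: scalar_prod_def block_inner_def atLeast0LessThan)

lemma partial_hadamard_iff:
  "partial_hadamard m n H \<longleftrightarrow> H \<in> carrier_mat m n \<and>
    (\<forall>r<m. \<forall>k<n. H $$ (r, k) \<in> {1, -1}) \<and>
    (\<forall>r<m. \<forall>s<m. r \<noteq> s \<longrightarrow> block_inner (\<lambda>r k. H $$ (r, k)) {..<n} r s = 0)"
proof (cases "H \<in> carrier_mat m n")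
  case True
  have el: "elements_mat H \<subseteq> {1, -1} \<longleftrightarrow> (\<forall>r<m. \<forall>k<n. H $$ (r, k) \<in> {1, -1})"
    (is "_ \<longleftrightarrow> ?pm")
  proof
    assume "elements_mat H \<subseteq> {1, -1}"
    then show ?pm using elements_matI[OF True _ _ refl] by blast
  next
    assume ?pm
    then show "elements_mat H \<subseteq> {1, -1}" using True by (auto dest!: elements_matD)
  qed
  have "H * transpose_mat H = int n \<cdot>\<^sub>m 1\<^sub>m m \<longleftrightarrow>
    (\<forall>r<m. \<forall>s<m. r \<noteq> s \<longrightarrow> block_inner (\<lambda>r k. H $$ (r, k)) {..<n} r s = 0)"
    (is "?L \<longleftrightarrow> ?R") if pm: ?pm
  proof
    assume ?L
    show ?R
    proof (intro allI impI)
      fix r s assume "r < m" "s < m" "r \<noteq> s"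
      then show "block_inner (\<lambda>r k. H $$ (r, k)) {..<n} r s = 0"
        using gram_index[OF True, of r s] \<open>?L\<close> by simp
    qed
  next
    assume ?R
    have "(H * transpose_mat H) $$ (r, s) = (int n \<cdot>\<^sub>m 1\<^sub>m m) $$ (r, s)"
      if rs: "r < m" "s < m" for r s
      using gram_index[OF True rs] \<open>?R\<close> rs
        block_inner_self[of "{..<n}" "\<lambda>r k. H $$ (r, k)" r] pm
      by (cases "r = s") auto
    then show ?L using True by (intro eq_matI) auto
  qed
  then show ?thesis using True el unfolding partial_hadamard_def by blast
qed (simp add: partial_hadamard_def)

section \<open>From a splittable matrix to an array\<close>

text \<open>The matrix $w$ is obtained from $H$ by negating rows. This preserves the absolute values of
all inner products, and the signs are chosen by \<open>sign_normalisation\<close>.\<close>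

lemma multi_splittable_normal_form:
  assumes p: "p mod 4 = 3" and H: "partial_hadamard (p\<^sup>2) (p * (p + 1)) H"
    and split: "balancedly_multi_splittable p H"
  shows "\<exists>(w :: nat \<Rightarrow> nat \<Rightarrow> int) \<B>. card \<B> = p + 1 \<and> (\<forall>B\<in>\<B>. finite B \<and> card B = p) \<and>
    (\<forall>r<p\<^sup>2. \<forall>B\<in>\<B>. \<forall>k\<in>B. w r k \<in> {1, -1}) \<and>
    (\<forall>r<p\<^sup>2. \<forall>s<p\<^sup>2. r \<noteq> s \<longrightarrow> (\<exists>B\<in>\<B>. block_inner w B r s = int p \<and>
      (\<forall>B'\<in>\<B> - {B}. block_inner w B' r s = -1)))"
proof -
  define q where "q = (p + 1) div 2"
  have pq: "p + 1 = 2 * q" "q \<ge> 2" and p1: "p > 1"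
    using p unfolding q_def by presburger+
  have pq': "2 * int q - 1 = int p" using pq(1) by linarith
  define h where "h r k = H $$ (r, k)" for r k
  have Hc: "H \<in> carrier_mat (p\<^sup>2) (p * (p + 1))"
    and pm: "\<And>r k. r < p\<^sup>2 \<Longrightarrow> k < p * (p + 1) \<Longrightarrow> h r k \<in> {1, -1}"
    and orth: "\<And>r s. r < p\<^sup>2 \<Longrightarrow> s < p\<^sup>2 \<Longrightarrow> r \<noteq> s \<Longrightarrow> block_inner h {..<p * (p + 1)} r s = 0"
    using H unfolding partial_hadamard_iff h_def by blast+
  obtain \<B> where part: "partition_on {..<p * (p + 1)} \<B>" and card_\<B>: "card \<B> = p + 1"
    and card_B: "\<And>B. B \<in> \<B> \<Longrightarrow> card B = p"
    and spl: "\<And>\<C>. \<C> \<subseteq> \<B> \<Longrightarrow> card \<C> = q \<Longrightarrow> balancedly_splittable_wrt H (\<Union>\<C>) (int q)"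
    using split unfolding balancedly_multi_splittable_def q_def by blast
  have fin_\<B>: "finite \<B>" using card_\<B> card_ge_0_finite[of \<B>] by simp
  have Un: "\<Union>\<B> = {..<p * (p + 1)}" and dis: "disjoint \<B>"
    using part by (auto simp: partition_on_def)
  have fin_B: "finite B" if "B \<in> \<B>" for B
    using card_B[OF that] p1 card_ge_0_finite[of B] by simp
  have Un_inner: "block_inner h (\<Union>\<C>) r s = (\<Sum>B\<in>\<C>. block_inner h B r s)" if "\<C> \<subseteq> \<B>" for \<C> r s
    using dis that fin_B by (intro block_inner_Union) (auto intro: pairwise_subset)
  have pm': "h r k \<in> {1, -1}" if "r \<in> {..<p\<^sup>2}" "B \<in> \<B>" "k \<in> B" for r B k
    using pm[of r k] that Un by auto
  have signed: "\<exists>e\<in>{1, -1}. \<exists>B\<in>\<B>. block_inner h B r s = e * int p \<and>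
    (\<forall>B'\<in>\<B> - {B}. block_inner h B' r s = - e)"
    if rs: "r \<in> {..<p\<^sup>2}" "s \<in> {..<p\<^sup>2}" "r \<noteq> s" for r s
  proof -
    have "(\<Sum>B\<in>\<B>. block_inner h B r s) = 0"
      using Un_inner[of \<B> r s] orth[of r s] rs Un by simp
    moreover have "(\<Sum>B\<in>\<C>. block_inner h B r s) \<in> {int q, - int q}"
      if \<C>: "\<C> \<subseteq> \<B>" "card \<C> = q" for \<C>
    proof -
      have sub: "\<Union>\<C> \<subseteq> {..<p * (p + 1)}" using \<C> Un by blast
      have "(submatrix H UNIV (\<Union>\<C>) * transpose_mat (submatrix H UNIV (\<Union>\<C>))) $$ (r, s)
          \<in> {int q, - int q}"
        using spl[OF \<C>] rs Hc unfolding balancedly_splittable_wrt_def Let_def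
        by (metis carrier_matD(1) lessThan_iff)
      then have "block_inner h (\<Union>\<C>) r s \<in> {int q, - int q}"
        using gram_submatrix[OF Hc sub, of r s] rs unfolding h_def by simp
      then show ?thesis using Un_inner[OF \<C>(1)] by simp
    qed
    ultimately show ?thesis
      using subset_sums_exceptional_entry[OF fin_\<B> _ pq(2), of "\<lambda>B. block_inner h B r s"]
        card_\<B> pq(1) unfolding pq' by simp
  qed
  have "\<exists>u. (\<forall>r\<in>{..<p\<^sup>2}. u r \<in> {1, -1}) \<and> (\<forall>r\<in>{..<p\<^sup>2}. \<forall>s\<in>{..<p\<^sup>2}. r \<noteq> s \<longrightarrow>
    (\<exists>B\<in>\<B>. block_inner h B r s = u r * u s * int p \<and>
      (\<forall>B'\<in>\<B> - {B}. block_inner h B' r s = - (u r * u s))))"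
    by (rule sign_normalisation[OF pm' fin_B card_B p1 signed])
  then obtain u where u: "\<forall>r\<in>{..<p\<^sup>2}. u r \<in> {1, -1}"
    and uB: "\<forall>r\<in>{..<p\<^sup>2}. \<forall>s\<in>{..<p\<^sup>2}. r \<noteq> s \<longrightarrow>
      (\<exists>B\<in>\<B>. block_inner h B r s = u r * u s * int p \<and>
        (\<forall>B'\<in>\<B> - {B}. block_inner h B' r s = - (u r * u s)))"
    by (elim exE conjE) (rule that)
  define w where "w r k = u r * h r k" for r k
  have "w r k \<in> {1, -1}" if "r < p\<^sup>2" "B \<in> \<B>" "k \<in> B" for r B k
    using pm'[of r B k] u[rule_format, of r] that unfolding w_def by auto
  moreover have "\<exists>B\<in>\<B>. block_inner w B r s = int p \<and> (\<forall>B'\<in>\<B> - {B}. block_inner w B' r s = -1)"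
    if rs: "r < p\<^sup>2" "s < p\<^sup>2" "r \<noteq> s" for r s
  proof -
    obtain B where B: "B \<in> \<B>" "block_inner h B r s = u r * u s * int p"
      "\<And>B'. B' \<in> \<B> - {B} \<Longrightarrow> block_inner h B' r s = - (u r * u s)"
      using uB[rule_format, of r s] rs by auto
    have sq: "u r * u s * (u r * u s) = 1"
      using u[rule_format, of r] u[rule_format, of s] rs by auto
    have w: "block_inner w B' r s = u r * u s * block_inner h B' r s" for B'
      unfolding w_def by (rule block_inner_scale)
    show ?thesis
    proof (intro bexI conjI ballI)
      show "block_inner w B r s = int p"
        unfolding w B(2) using sq by (simp only: mult.assoc[symmetric] mult_1)
      show "block_inner w B' r s = -1" if "B' \<in> \<B> - {B}" for B'
        unfolding w B(3)[OF that] using sq by simp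
    qed (rule B(1))
  qed
  ultimately show ?thesis using card_\<B> card_B fin_B by (intro exI[of _ w] exI[of _ \<B>]) simp
qed

text \<open>Coinciding on a block is an equivalence relation on the rows, and these relations satisfy the
hypotheses of \<open>affine_plane_class_card\<close>. A single class cannot contain all rows: any other
block would then carry $p^2$ vectors with pairwise inner product $-1$, while \<open>simplex_card_le\<close>
allows at most $p + 1$.\<close>

lemma array_and_core_of_normal_form:
  fixes w :: "nat \<Rightarrow> 'c \<Rightarrow> int"
  assumes p: "p > 1" and card_\<B>: "card \<B> = p + 1"
    and fin_B: "\<And>B. B \<in> \<B> \<Longrightarrow> finite B" and card_B: "\<And>B. B \<in> \<B> \<Longrightarrow> card B = p"
    and pm: "\<And>r B k. r < p\<^sup>2 \<Longrightarrow> B \<in> \<B> \<Longrightarrow> k \<in> B \<Longrightarrow> w r k \<in> {1, -1}"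
    and pair: "\<And>r s. r < p\<^sup>2 \<Longrightarrow> s < p\<^sup>2 \<Longrightarrow> r \<noteq> s \<Longrightarrow>
      \<exists>B\<in>\<B>. block_inner w B r s = int p \<and> (\<forall>B'\<in>\<B> - {B}. block_inner w B' r s = -1)"
  shows "\<exists>A. orthogonal_array (p\<^sup>2) (p + 1) p {..<p} A" and "\<exists>K. partial_hadamard p (p + 1) K"
proof -
  have fin_\<B>: "finite \<B>" using card_\<B> card_ge_0_finite[of \<B>] by simp
  define E where "E B = {(r, s). r < p\<^sup>2 \<and> s < p\<^sup>2 \<and> (\<forall>k\<in>B. w r k = w s k)}" for B
  have equiv: "equiv {..<p\<^sup>2} (E B)" for B
    by (rule equivI) (auto simp: E_def refl_on_def sym_def trans_def)
  have E_iff: "(r, s) \<in> E B \<longleftrightarrow> block_inner w B r s = int p"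
    if rs: "r < p\<^sup>2" "s < p\<^sup>2" and B: "B \<in> \<B>" for r s B
  proof
    assume "(r, s) \<in> E B"
    then have "block_inner w B r s = 1 * block_inner w B s s"
      by (intro block_inner_cong_row) (auto simp: E_def)
    then show "block_inner w B r s = int p"
      using block_inner_self[of B w s] pm[OF rs(2) B] card_B[OF B] by simp
  next
    assume ext: "block_inner w B r s = int p"
    have "w r k = 1 * w s k" if "k \<in> B" for k
      using fin_B[OF B] pm[OF rs(1) B] pm[OF rs(2) B] ext card_B[OF B] that
      by (intro block_inner_extreme[of B w r s 1 k]) simp_all
    then show "(r, s) \<in> E B" using rs by (simp add: E_def)
  qed
  have join: "\<exists>!B. B \<in> \<B> \<and> (r, s) \<in> E B" if rs: "r < p\<^sup>2" "s < p\<^sup>2" "r \<noteq> s" for r s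
  proof -
    obtain B where B: "B \<in> \<B>" "block_inner w B r s = int p"
      and B': "\<And>B'. B' \<in> \<B> - {B} \<Longrightarrow> block_inner w B' r s = -1" using pair[OF rs] by blast
    show ?thesis
    proof (rule ex1I[of _ B])
      show "B \<in> \<B> \<and> (r, s) \<in> E B" using B E_iff rs by simp
      show "B' = B" if "B' \<in> \<B> \<and> (r, s) \<in> E B'" for B'
        using that B'[of B'] E_iff[of r s B'] rs by auto
    qed
  qed
  have elsewhere: "block_inner w B' r s = -1"
    if rs: "r \<noteq> s" "(r, s) \<in> E B" and B: "B \<in> \<B>" "B' \<in> \<B>" "B' \<noteq> B" for r s B B'
  proof -
    have lt: "r < p\<^sup>2" "s < p\<^sup>2" using rs by (auto simp: E_def)
    obtain B0 where B0: "B0 \<in> \<B>" "\<And>B'. B' \<in> \<B> - {B0} \<Longrightarrow> block_inner w B' r s = -1"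
      using pair[OF lt rs(1)] by blast
    have "B = B0" using B0(2)[of B] E_iff[OF lt B(1)] rs B by auto
    then show ?thesis using B0(2)[of B'] B by simp
  qed
  have other: "\<exists>B'\<in>\<B>. B' \<noteq> B" for B
  proof (rule ccontr)
    assume "\<not> ?thesis"
    then have "card \<B> \<le> card {B}" by (intro card_mono) auto
    then show False using card_\<B> p by simp
  qed
  have proper: "E B `` {r} \<noteq> {..<p\<^sup>2}" if B: "B \<in> \<B>" for B r
  proof
    assume full: "E B `` {r} = {..<p\<^sup>2}"
    obtain B' where B': "B' \<in> \<B>" "B' \<noteq> B" using other by blast
    have all: "(s, t) \<in> E B" if "s < p\<^sup>2" "t < p\<^sup>2" for s t
    proof -
      have "(r, s) \<in> E B" "(r, t) \<in> E B" using full that by blast+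
      then show ?thesis by (auto simp: E_def)
    qed
    have "card {..<p\<^sup>2} \<le> p + 1"
    proof (rule simplex_card_le)
      show "block_inner w B' s s = int p" if "s \<in> {..<p\<^sup>2}" for s
        using block_inner_self[of B' w s] pm[of s B'] that B' card_B by simp
      show "block_inner w B' s t = -1" if "s \<in> {..<p\<^sup>2}" "t \<in> {..<p\<^sup>2}" "s \<noteq> t" for s t
        using elsewhere[OF that(3) all B B'] that by simp
    qed (use fin_B B' in auto)
    then have "p * p \<le> p + 1" by (simp add: power2_eq_square)
    moreover have "2 * p \<le> p * p" using p by simp
    ultimately show False using p by linarith
  qed
  have cls: "card (E B `` {r}) = p" if "B \<in> \<B>" "r < p\<^sup>2" for B r
    by (rule affine_plane_class_card[of "{..<p\<^sup>2}" p \<B> E])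
      (use that fin_\<B> card_\<B> equiv join proper in auto)
  show "\<exists>A. orthogonal_array (p\<^sup>2) (p + 1) p {..<p} A"
  proof (rule orthogonal_array_of_affine_plane[of p \<B> "p + 1" E])
    show "(r, s) \<notin> E B'"
      if "B \<in> \<B>" "B' \<in> \<B>" "B \<noteq> B'" "r \<noteq> s" "(r, s) \<in> E B" for B B' r s
    proof -
      have "r < p\<^sup>2" "s < p\<^sup>2" using that(5) by (auto simp: E_def)
      then show ?thesis using join[of r s] that by blast
    qed
  qed (use p card_\<B> fin_\<B> equiv cls in auto)
  \<comment> \<open>A line of another class contains one row from each class of \<open>B\<close>, so no representatives of
    the classes of \<open>B\<close> have to be chosen.\<close>
  obtain B where B: "B \<in> \<B>" using other by blast
  obtain B' where B': "B' \<in> \<B>" "B' \<noteq> B" using other by blast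
  define X where "X = E B' `` {0}"
  have X: "card X = p" using cls[OF B'(1), of 0] p X_def by simp
  have fin_X: "finite X" using X p card_ge_0_finite[of X] by simp
  have X_lt: "r < p\<^sup>2" if "r \<in> X" for r using that by (auto simp: X_def E_def)
  have X_inner: "block_inner w B r s = -1" if "r \<in> X" "s \<in> X" "r \<noteq> s" for r s
  proof (rule elsewhere[OF that(3) _ B'(1) B B'(2)[symmetric]])
    show "(r, s) \<in> E B'" using that by (auto simp: X_def E_def)
  qed
  obtain f where f: "bij_betw f {..<p} X"
    using ex_bij_betw_nat_finite[OF fin_X] X by (auto simp: atLeast0LessThan)
  obtain b where b: "bij_betw b {..<p} B"
    using ex_bij_betw_nat_finite[OF fin_B[OF B]] card_B[OF B] by (auto simp: atLeast0LessThan)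
  define K where "K = mat p (p + 1) (\<lambda>(c, k). if k = 0 then 1 else w (f c) (b (k - 1)))"
  have fX: "f c \<in> X" if "c < p" for c using f that by (auto simp: bij_betw_def)
  have bB: "b k \<in> B" if "k < p" for k using b that by (auto simp: bij_betw_def)
  have "partial_hadamard p (p + 1) K"
    unfolding partial_hadamard_iff
  proof (intro conjI allI impI)
    show "K $$ (c, k) \<in> {1, -1}" if "c < p" "k < p + 1" for c k
      using that pm[OF X_lt[OF fX] B bB, of c "k - 1"] by (auto simp: K_def)
    show "block_inner (\<lambda>r k. K $$ (r, k)) {..<p + 1} c d = 0"
      if cd: "c < p" "d < p" "c \<noteq> d" for c d
    proof -
      have ne: "f c \<noteq> f d" using f cd by (auto simp: bij_betw_def inj_on_def)
      have "block_inner (\<lambda>r k. K $$ (r, k)) {..<p + 1} c d =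
          1 + (\<Sum>k<p. w (f c) (b k) * w (f d) (b k))"
        using cd by (simp add: block_inner_def sum.lessThan_Suc_shift K_def del: sum.lessThan_Suc)
      also have "(\<Sum>k<p. w (f c) (b k) * w (f d) (b k)) = block_inner w B (f c) (f d)"
        unfolding block_inner_def by (rule sum.reindex_bij_betw[OF b])
      also have "\<dots> = -1" using X_inner[OF fX fX ne] cd by simp
      finally show ?thesis by simp
    qed
  qed (simp add: K_def)
  then show "\<exists>K. partial_hadamard p (p + 1) K" by blast
qed

section \<open>From an array to a splittable matrix\<close>

text \<open>Multiplying each row of $K$ by its first entry turns the first column into ones without
changing orthogonality. Deleting that column lowers every inner product by $1$.\<close>

lemma simplex_of_partial_hadamard:
  assumes K: "partial_hadamard p (p + 1) K" and S: "finite S" "card S = p"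
  shows "\<exists>L :: 'a \<Rightarrow> nat \<Rightarrow> int. (\<forall>x\<in>S. \<forall>k<p. L x k \<in> {1, -1}) \<and>
    (\<forall>x\<in>S. \<forall>y\<in>S. block_inner L {..<p} x y = (if x = y then int p else -1))"
proof -
  obtain g where g: "bij_betw g S {..<p}"
    using finite_same_card_bij[of S "{..<p}"] S by auto
  have gp: "g x < p" if "x \<in> S" for x using g that by (auto simp: bij_betw_def)
  have pm: "K $$ (c, k) \<in> {1, -1}" if "c < p" "k < p + 1" for c k
    using K that unfolding partial_hadamard_iff by blast
  define L where "L x k = K $$ (g x, 0) * K $$ (g x, Suc k)" for x k
  have L: "L x k \<in> {1, -1}" if "x \<in> S" "k < p" for x k
    using pm[OF gp, of x 0] pm[OF gp, of x "Suc k"] that unfolding L_def by auto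
  have "block_inner L {..<p} x y = -1" if xy: "x \<in> S" "y \<in> S" "x \<noteq> y" for x y
  proof -
    let ?a = "K $$ (g x, 0)" and ?b = "K $$ (g y, 0)"
    have "g x \<noteq> g y" using g xy by (auto simp: bij_betw_def inj_on_def)
    then have "block_inner (\<lambda>r k. K $$ (r, k)) {..<p + 1} (g x) (g y) = 0"
      using K gp xy unfolding partial_hadamard_iff by blast
    then have *: "?a * ?b + (\<Sum>k<p. K $$ (g x, Suc k) * K $$ (g y, Suc k)) = 0"
      by (simp add: block_inner_def sum.lessThan_Suc_shift del: sum.lessThan_Suc)
    have "block_inner L {..<p} x y = ?a * ?b * (\<Sum>k<p. K $$ (g x, Suc k) * K $$ (g y, Suc k))"
      by (simp add: block_inner_def L_def sum_distrib_left mult_ac)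
    also have "(\<Sum>k<p. K $$ (g x, Suc k) * K $$ (g y, Suc k)) = - (?a * ?b)" using * by simp
    also have "?a * ?b * - (?a * ?b) = -1"
      using pm[OF gp[OF xy(1)], of 0] pm[OF gp[OF xy(2)], of 0] by auto
    finally show ?thesis .
  qed
  moreover have "block_inner L {..<p} x x = int p" if "x \<in> S" for x
    using block_inner_self[of "{..<p}" L x] L[OF that] by simp
  ultimately show ?thesis using L by (intro exI[of _ L]) auto
qed

text \<open>Each symbol $x$ of the array is replaced by the row vector $L_x$, so that the $c$-th column
of the array becomes a block of $p$ consecutive columns. Two rows have inner product $p$ on the block of
the only column where the array rows agree, and $-1$ on the other blocks.\<close>

lemma splittable_of_array_and_simplex:
  fixes L :: "'a \<Rightarrow> nat \<Rightarrow> int"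
  assumes p: "odd p" and oa: "orthogonal_array (p\<^sup>2) (p + 1) p S A"
    and L: "\<And>x k. x \<in> S \<Longrightarrow> k < p \<Longrightarrow> L x k \<in> {1, -1}"
    and inner: "\<And>x y. x \<in> S \<Longrightarrow> y \<in> S \<Longrightarrow> block_inner L {..<p} x y = (if x = y then int p else -1)"
  shows "\<exists>H. partial_hadamard (p\<^sup>2) (p * (p + 1)) H \<and> balancedly_multi_splittable p H"
proof -
  define q where "q = (p + 1) div 2"
  have p0: "p > 0" and pq: "p + 1 = 2 * q" using p unfolding q_def by (auto elim: oddE)
  have A: "A \<in> carrier_mat (p\<^sup>2) (p + 1)" and el: "elements_mat A \<subseteq> S"
    using oa by (simp_all add: orthogonal_array_def)
  have A_mem: "A $$ (r, c) \<in> S" if "r < p\<^sup>2" "c < p + 1" for r c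
    using el elements_matI[OF A that refl] by blast
  define H where "H = mat (p\<^sup>2) (p * (p + 1)) (\<lambda>(r, k). L (A $$ (r, k div p)) (k mod p))"
  have Hc: "H \<in> carrier_mat (p\<^sup>2) (p * (p + 1))" by (simp add: H_def)
  have H_idx: "H $$ (r, k) = L (A $$ (r, k div p)) (k mod p)" if "r < p\<^sup>2" "k < p * (p + 1)" for r k
    using that by (simp add: H_def)
  define h where "h r k = H $$ (r, k)" for r k
  define B where "B c = {c * p..<c * p + p}" for c
  define \<B> where "\<B> = B ` {..<p + 1}"
  have B_iff: "k \<in> B c \<longleftrightarrow> k div p = c" for k c
  proof
    show "k div p = c" if "k \<in> B c"
      using that by (intro div_nat_eqI) (auto simp: B_def mult.commute)
    show "k \<in> B c" if "k div p = c"
      using div_mult_mod_eq[of k p] mod_less_divisor[OF p0, of k]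
      unfolding B_def that[symmetric] atLeastLessThan_iff by (intro conjI) linarith+
  qed
  have inj_B: "inj_on B {..<p + 1}"
  proof (rule inj_onI)
    fix c d assume "B c = B d"
    moreover have "c * p \<in> B c" using p0 by (simp add: B_def)
    ultimately show "c = d" using B_iff p0 by simp
  qed
  have card_\<B>: "card \<B> = p + 1" unfolding \<B>_def using inj_B by (simp add: card_image)
  have fin_\<B>: "finite \<B>" by (simp add: \<B>_def)
  have in_range: "k < p * (p + 1) \<longleftrightarrow> k div p < p + 1" for k
    using p0 by (simp add: div_less_iff_less_mult mult.commute)
  have part: "partition_on {..<p * (p + 1)} \<B>"
    unfolding partition_on_def
  proof (intro conjI)
    show "\<Union>\<B> = {..<p * (p + 1)}" unfolding \<B>_def using B_iff in_range by auto
    show "disjoint \<B>" unfolding \<B>_def disjoint_def using B_iff by auto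
    show "{} \<notin> \<B>" unfolding \<B>_def B_def using p0 by auto
  qed
  have B_inner: "block_inner h (B c) r s = (if A $$ (r, c) = A $$ (s, c) then int p else -1)"
    if rs: "r < p\<^sup>2" "s < p\<^sup>2" and c: "c < p + 1" for r s c
  proof -
    have bij: "bij_betw (\<lambda>k. c * p + k) {..<p} (B c)"
      unfolding B_def by (simp add: bij_betw_def lessThan_atLeast0 add.commute)
    have "block_inner h (B c) r s = (\<Sum>k<p. h r (c * p + k) * h s (c * p + k))"
      unfolding block_inner_def by (rule sum.reindex_bij_betw[OF bij, symmetric])
    also have "\<dots> = block_inner L {..<p} (A $$ (r, c)) (A $$ (s, c))"
      unfolding block_inner_def
    proof (rule sum.cong[OF refl])
      fix k assume "k \<in> {..<p}"
      then have "(c * p + k) div p = c" "(c * p + k) mod p = k" by auto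
      then show "h r (c * p + k) * h s (c * p + k) = L (A $$ (r, c)) k * L (A $$ (s, c)) k"
        using rs c H_idx[of _ "c * p + k"] in_range[of "c * p + k"] by (simp add: h_def)
    qed
    finally show ?thesis using inner A_mem rs c by simp
  qed
  have Un_inner: "block_inner h (\<Union>\<C>) r s = (\<Sum>C\<in>\<C>. block_inner h C r s)" if "\<C> \<subseteq> \<B>" for \<C> r s
  proof (rule block_inner_Union)
    show "pairwise disjnt \<C>"
      using part that pairwise_subset unfolding partition_on_def by blast
    show "finite C" if "C \<in> \<C>" for C using that \<open>\<C> \<subseteq> \<B>\<close> by (auto simp: \<B>_def B_def)
  qed
  \<comment> \<open>Each block contributes \<open>-1\<close>, and the exceptional one \<open>p + 1\<close> more. Orthogonality and
    splittability are the cases of all blocks and of half of them.\<close>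
  have sums: "\<exists>C\<in>\<B>. \<forall>\<C>\<subseteq>\<B>. block_inner h (\<Union>\<C>) r s =
      (if C \<in> \<C> then int p + 1 else 0) - int (card \<C>)"
    if rs: "r < p\<^sup>2" "s < p\<^sup>2" "r \<noteq> s" for r s
  proof -
    obtain c where c: "c < p + 1" "A $$ (r, c) = A $$ (s, c)"
      and c_uniq: "\<And>d. d < p + 1 \<Longrightarrow> A $$ (r, d) = A $$ (s, d) \<Longrightarrow> d = c"
      using orthogonal_array_rows_agree_once[OF oa rs] by blast
    have val: "block_inner h D r s = (if D = B c then int p + 1 else 0) - 1" if "D \<in> \<B>" for D
    proof -
      obtain d where d: "d < p + 1" "D = B d" using \<open>D \<in> \<B>\<close> by (auto simp: \<B>_def)
      have "D = B c \<longleftrightarrow> d = c"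
        unfolding d(2) using inj_B d(1) c(1) by (intro inj_on_eq_iff) auto
      moreover have "A $$ (r, d) = A $$ (s, d) \<longleftrightarrow> d = c" using c c_uniq[OF d(1)] by blast
      ultimately show ?thesis using B_inner[OF rs(1,2) d(1)] d(2) by simp
    qed
    show ?thesis
    proof (intro bexI[of _ "B c"] allI impI)
      fix \<C> assume sub: "\<C> \<subseteq> \<B>"
      then have fin: "finite \<C>" using fin_\<B> finite_subset by blast
      have "block_inner h (\<Union>\<C>) r s = (\<Sum>D\<in>\<C>. (if D = B c then int p + 1 else 0) - 1)"
        unfolding Un_inner[OF sub] by (rule sum.cong[OF refl val]) (use sub in blast)
      also have "\<dots> = (if B c \<in> \<C> then int p + 1 else 0) - int (card \<C>)"
        using fin by (simp add: sum_subtractf)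
      finally show "block_inner h (\<Union>\<C>) r s = (if B c \<in> \<C> then int p + 1 else 0) - int (card \<C>)" .
    qed (use c in \<open>auto simp: \<B>_def\<close>)
  qed
  have "partial_hadamard (p\<^sup>2) (p * (p + 1)) H"
    unfolding partial_hadamard_iff
  proof (intro conjI allI impI)
    fix r k assume rk: "r < p\<^sup>2" "k < p * (p + 1)"
    then show "H $$ (r, k) \<in> {1, -1}"
      unfolding H_idx[OF rk] using in_range[of k] p0 by (intro L A_mem) auto
  next
    fix r s assume rs: "r < p\<^sup>2" "s < p\<^sup>2" "r \<noteq> s"
    have Un: "\<Union>\<B> = {..<p * (p + 1)}" using part by (simp add: partition_on_def)
    obtain C where "C \<in> \<B>"
      "block_inner h (\<Union>\<B>) r s = (if C \<in> \<B> then int p + 1 else 0) - int (card \<B>)"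
      using sums[OF rs] by blast
    then show "block_inner (\<lambda>r k. H $$ (r, k)) {..<p * (p + 1)} r s = 0"
      unfolding Un card_\<B> h_def by simp
  qed (rule Hc)
  moreover have "balancedly_multi_splittable p H"
    unfolding balancedly_multi_splittable_def q_def[symmetric]
  proof (intro exI[of _ \<B>] conjI allI impI ballI)
    show "card C = p" if "C \<in> \<B>" for C using that by (auto simp: \<B>_def B_def)
    fix \<C> assume \<C>: "\<C> \<subseteq> \<B>" "card \<C> = q"
    have sub: "\<Union>\<C> \<subseteq> {..<p * (p + 1)}" using \<C> part by (auto simp: partition_on_def)
    show "balancedly_splittable_wrt H (\<Union>\<C>) (int q)"
      unfolding balancedly_splittable_wrt_def Let_def
    proof (intro allI impI)
      fix r s assume "r < dim_row H" "s < dim_row H" "r \<noteq> s"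
      then have rs: "r < p\<^sup>2" "s < p\<^sup>2" "r \<noteq> s" using Hc by auto
      obtain C where
        "block_inner h (\<Union>\<C>) r s = (if C \<in> \<C> then int p + 1 else 0) - int (card \<C>)"
        using sums[OF rs] \<C> by blast
      moreover have "int p + 1 = 2 * int q" using pq by linarith
      ultimately have "block_inner h (\<Union>\<C>) r s \<in> {int q, - int q}" using \<C>(2) by simp
      then show "(submatrix H UNIV (\<Union>\<C>) * transpose_mat (submatrix H UNIV (\<Union>\<C>))) $$ (r, s)
          \<in> {int q, - int q}"
        unfolding gram_submatrix[OF Hc sub rs(1,2)] h_def .
    qed
  qed (rule part, rule card_\<B>)
  ultimately show ?thesis by blast
qed

theorem theorem2p1:
  fixes p :: nat
  assumes "p > 0" and "p mod 4 = 3"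
  shows "(\<exists>H. partial_hadamard (p\<^sup>2) (p * (p + 1)) H \<and> balancedly_multi_splittable p H)
     \<longleftrightarrow> (\<exists>(S :: nat set) A. orthogonal_array (p\<^sup>2) (p + 1) p S A) \<and>
         (\<exists>K. partial_hadamard p (p + 1) K)"
proof
  assume "\<exists>H. partial_hadamard (p\<^sup>2) (p * (p + 1)) H \<and> balancedly_multi_splittable p H"
  then obtain H where "partial_hadamard (p\<^sup>2) (p * (p + 1)) H" "balancedly_multi_splittable p H"
    by blast
  from multi_splittable_normal_form[OF assms(2) this]
  obtain w :: "nat \<Rightarrow> nat \<Rightarrow> int" and \<B> where nf: "card \<B> = p + 1"
    "\<forall>B\<in>\<B>. finite B \<and> card B = p" "\<forall>r<p\<^sup>2. \<forall>B\<in>\<B>. \<forall>k\<in>B. w r k \<in> {1, -1}"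
    "\<forall>r<p\<^sup>2. \<forall>s<p\<^sup>2. r \<noteq> s \<longrightarrow> (\<exists>B\<in>\<B>. block_inner w B r s = int p \<and>
      (\<forall>B'\<in>\<B> - {B}. block_inner w B' r s = -1))"
    by (elim exE conjE) (rule that)
  have "p > 1" using assms(2) by presburger
  note core = array_and_core_of_normal_form[OF this nf(1)
      nf(2)[rule_format, THEN conjunct1] nf(2)[rule_format, THEN conjunct2]
      nf(3)[rule_format] nf(4)[rule_format]]
  have "\<exists>A. orthogonal_array (p\<^sup>2) (p + 1) p {..<p} A" "\<exists>K. partial_hadamard p (p + 1) K"
    by (rule core; assumption)+
  then show "(\<exists>(S :: nat set) A. orthogonal_array (p\<^sup>2) (p + 1) p S A) \<and>
      (\<exists>K. partial_hadamard p (p + 1) K)"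
    by blast
next
  assume "(\<exists>(S :: nat set) A. orthogonal_array (p\<^sup>2) (p + 1) p S A) \<and>
      (\<exists>K. partial_hadamard p (p + 1) K)"
  then obtain S :: "nat set" and A K where oa: "orthogonal_array (p\<^sup>2) (p + 1) p S A"
    and K: "partial_hadamard p (p + 1) K" by blast
  have "finite S" "card S = p" using oa by (simp_all add: orthogonal_array_def)
  from simplex_of_partial_hadamard[OF K this] obtain L :: "nat \<Rightarrow> nat \<Rightarrow> int"
    where "\<forall>x\<in>S. \<forall>k<p. L x k \<in> {1, -1}"
      "\<forall>x\<in>S. \<forall>y\<in>S. block_inner L {..<p} x y = (if x = y then int p else -1)"
    by (elim exE conjE) (rule that)
  moreover have "odd p" using assms(2) by presburger
  ultimately show "\<exists>H. partial_hadamard (p\<^sup>2) (p * (p + 1)) H \<and> balancedly_multi_splittable p H"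
    using splittable_of_array_and_simplex[OF _ oa, of L] by blast
qed

end
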